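(* There exists an absolute constant $c>0$ such that, for all sufficiently large integers $l$, \[ r_3(l,l,l) \geq 2^{\,l^{\,c \log \log l}}. \]
   Context: For a positive integer $l$, the $3$-colour $3$-uniform hypergraph Ramsey number $r_3(l,l,l)$ is the smallest positive integer $N$ such that for every colouring of the $3$-element subsets of an $N$-element set with three colours, there exist a colour and an $l$-element subset $S$ all of whose $3$-element subsets receive that colour (i.e. a monochromatic copy of the complete $3$-uniform hypergraph $K_l^{(3)}$). Here $\log$ denotes the logarithm to base $2$. *)

theory Defs
  imports Complex_Main "HOL-Library.Ramsey"
begin

definition r3 :: "nat \<Rightarrow> nat \<Rightarrow> nat \<Rightarrow> nat" where
  "r3 k l m = (LEAST N. 0 < N \<and> partn_lst {..<N} [k, l, m] 3)"

(* The set over which the minimum is taken is nonempty, so r3 is a genuine Ramsey number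
   rather than an unspecified value of LEAST. *)
lemma r3_welldefined: "0 < r3 k l m \<and> partn_lst {..<r3 k l m} [k, l, m] 3"
proof -
  obtain N :: nat where "partn_lst {..<N} [k, l, m] 3"
    using ramsey_full by blast
  then have "0 < Suc N \<and> partn_lst {..<Suc N} [k, l, m] 3"
    using partn_lst_greater_resource by auto
  then show ?thesis
    unfolding r3_def by (rule LeastI)
qed

end

theory Submission
  imports Defs "HOL-Real_Asymp.Real_Asymp"
begin

text \<open>
  Stepping up. Let \<open>\<delta>(x,y)\<close> be the highest binary digit in which \<open>x\<close> and \<open>y\<close> differ, and fix a
  red-blue colouring of the pairs below \<open>n\<close>. For \<open>x < y < z < 2\<^sup>n\<close> the digits \<open>\<delta>(x,y)\<close> and
  \<open>\<delta>(y,z)\<close> are distinct; the triple receives the third colour if this pair of digits is blue, and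
  otherwise one of the first two colours, according to which digit is larger. In a set
  monochromatic in one of the first two colours the digits are monotone and form a red clique,
  while in a set \<open>S\<close> of the third colour the digits along a longest branch of the binary tree
  spanned by \<open>S\<close> form a blue clique, so \<open>|S|\<close> is at most exponential in the size of that clique.
  Hence it suffices to colour the pairs below \<open>n = l powr (c * log l)\<close> without red cliques
  of size \<open>l - 1\<close> and without blue cliques of size \<open>log l\<close>; a random colouring in which blue has
  probability about \<open>1 / sqrt l\<close> does this.
\<close>

section \<open>The highest differing binary digit\<close>

text \<open>For \<open>x = y\<close> the value is 0, indistinguishable from a difference in the
  lowest digit; hence later facts assume distinct arguments.\<close>

definition delta :: "nat \<Rightarrow> nat \<Rightarrow> nat" where
  "delta x y = (LEAST d. x div 2 ^ Suc d = y div 2 ^ Suc d)"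

lemma div_power2_eq_mono:
  fixes x y :: nat
  assumes "x div 2 ^ a = y div 2 ^ a" "a \<le> b"
  shows "x div 2 ^ b = y div 2 ^ b"
proof -
  have "(2::nat) ^ b = 2 ^ a * 2 ^ (b - a)"
    using assms(2) by (simp flip: power_add)
  then show ?thesis
    using assms(1) by (simp add: div_mult2_eq)
qed

text \<open>Agreement after dropping low digits persists when more are dropped, so the least
  position decides all others. The properties of \<open>delta\<close> below reduce to this
  test.\<close>

lemma delta_less_iff:
  assumes "x \<noteq> y"
  shows "delta x y < d \<longleftrightarrow> x div 2 ^ d = y div 2 ^ d"
proof
  \<comment> \<open>Both quotients vanish at this crude position, so \<open>LEAST\<close> ranges
    over a nonempty set.\<close>
  have "x < 2 ^ Suc (x + y)" "y < 2 ^ Suc (x + y)"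
    using less_exp[of "Suc (x + y)"] by linarith+
  then have "x div 2 ^ Suc (x + y) = y div 2 ^ Suc (x + y)"
    by simp
  then have eq: "x div 2 ^ Suc (delta x y) = y div 2 ^ Suc (delta x y)"
    unfolding delta_def by (rule LeastI)
  then show "x div 2 ^ d = y div 2 ^ d" if "delta x y < d"
    using that by (metis Suc_leI div_power2_eq_mono)
  show "delta x y < d" if d: "x div 2 ^ d = y div 2 ^ d"
  proof (cases d)
    case 0
    then show ?thesis using d assms by simp
  next
    case (Suc e)
    then have "delta x y \<le> e"
      unfolding delta_def using d by (intro Least_le) simp
    then show ?thesis using Suc by simp
  qed
qed

lemma delta_eqI:
  assumes "x div 2 ^ Suc d = y div 2 ^ Suc d" "x div 2 ^ d \<noteq> y div 2 ^ d"
  shows "delta x y = d"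
proof -
  have "x \<noteq> y" using assms(2) by auto
  then show ?thesis
    using assms delta_less_iff[of x y d] delta_less_iff[of x y "Suc d"] by linarith
qed

text \<open>Division is monotone, so the quotient of \<open>y\<close> is squeezed between those of
  \<open>x\<close> and \<open>z\<close>: the outer two agree only if all three do.\<close>

lemma delta_max:
  assumes "x < y" "y < z"
  shows "delta x z = max (delta x y) (delta y z)"
proof -
  have "x div 2 ^ d = z div 2 ^ d \<longleftrightarrow> x div 2 ^ d = y div 2 ^ d \<and> y div 2 ^ d = z div 2 ^ d" for d
    using div_le_mono[of x y "2 ^ d"] div_le_mono[of y z "2 ^ d"] assms by auto
  then have "delta x z < d \<longleftrightarrow> max (delta x y) (delta y z) < d" for d
    using assms delta_less_iff[of x z] delta_less_iff[of x y] delta_less_iff[of y z] by auto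
  then show ?thesis
    by (metis less_irrefl linorder_neqE_nat)
qed

text \<open>At its highest differing digit an increasing pair goes from 0 to 1. If both digits were
  equal to \<open>d\<close>, digit \<open>d\<close> of \<open>y\<close> would be 1 and 0 at
  once.\<close>

lemma delta_neq:
  assumes "x < y" "y < z"
  shows "delta x y \<noteq> delta y z"
proof
  assume eq: "delta x y = delta y z"
  define d where "d = delta x y"
  have "x div 2 ^ d \<noteq> y div 2 ^ d" "y div 2 ^ d \<noteq> z div 2 ^ d"
    using assms delta_less_iff[of x y d] delta_less_iff[of y z d] eq d_def by auto
  moreover have "x div 2 ^ d \<le> y div 2 ^ d" "y div 2 ^ d \<le> z div 2 ^ d"
    using assms by (auto intro: div_le_mono)
  moreover have "x div 2 ^ Suc d = y div 2 ^ Suc d" "y div 2 ^ Suc d = z div 2 ^ Suc d"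
    using assms delta_less_iff[of x y "Suc d"] delta_less_iff[of y z "Suc d"] eq d_def by auto
  then have "x div 2 ^ d div 2 = y div 2 ^ d div 2" "y div 2 ^ d div 2 = z div 2 ^ d div 2"
    by (simp_all only: power_Suc2 div_mult2_eq)
  ultimately show False by linarith
qed

lemma delta_less:
  assumes "x \<noteq> y" "x < 2 ^ n" "y < 2 ^ n"
  shows "delta x y < n"
  using assms by (simp add: delta_less_iff)

section \<open>Stepping up from pairs to triples\<close>

text \<open>Measure everything from the least element \<open>m\<close>: \<open>delta_max\<close>
  gives \<open>delta m z = delta y z\<close> when the digits increase. So \<open>delta m\<close> is
  injective on the other elements and its values form the clique.\<close>

lemma increasing_delta_clique:
  assumes "finite S" "card S \<ge> 1" "S \<subseteq> {..<2 ^ n}"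
    and "\<And>x y z. \<lbrakk>x \<in> S; y \<in> S; z \<in> S; x < y; y < z\<rbrakk> \<Longrightarrow> delta x y < delta y z \<and> Q {delta x y, delta y z}"
  shows "\<exists>K \<subseteq> {..<n}. card S = card K + 1 \<and> (\<forall>e \<in> [K]\<^bsup>2\<^esup>. Q e)"
proof (intro exI conjI ballI)
  define m where "m = Min S"
  have m: "m \<in> S" using assms unfolding m_def by (intro Min_in) auto
  have m_less: "m < y" if "y \<in> S - {m}" for y
    using that assms(1) by (simp add: m_def le_neq_trans)
  have step: "delta m y < delta m z \<and> Q {delta m y, delta m z}"
    if "y \<in> S - {m}" "z \<in> S - {m}" "y < z" for y z
    using assms(4)[OF m, of y z] m_less[of y] delta_max[of m y z] that by auto
  let ?K = "delta m ` (S - {m})"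
  have "inj_on (delta m) (S - {m})"
    using step by (metis (no_types, lifting) inj_onI less_irrefl linorder_neqE_nat)
  then show "card S = card ?K + 1"
    using m assms(1,2) by (simp add: card_image)
  show "?K \<subseteq> {..<n}"
    using assms(3) m by (auto intro!: delta_less)
  show "Q e" if "e \<in> [?K]\<^bsup>2\<^esup>" for e
  proof -
    obtain y z where "y \<in> S - {m}" "z \<in> S - {m}" "y < z" "e = {delta m y, delta m z}"
      using \<open>e \<in> _\<close>
      by (elim nsets2_E) (auto, metis insert_commute linorder_neqE_nat)
    then show ?thesis using step by blast
  qed
qed

text \<open>Mirror image, measured from the greatest element \<open>m\<close>: here
  \<open>delta y m = delta y z\<close> for \<open>y < z < m\<close>.\<close>

lemma decreasing_delta_clique:
  assumes "finite S" "card S \<ge> 1" "S \<subseteq> {..<2 ^ n}"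
    and "\<And>x y z. \<lbrakk>x \<in> S; y \<in> S; z \<in> S; x < y; y < z\<rbrakk> \<Longrightarrow> delta y z < delta x y \<and> Q {delta x y, delta y z}"
  shows "\<exists>K \<subseteq> {..<n}. card S = card K + 1 \<and> (\<forall>e \<in> [K]\<^bsup>2\<^esup>. Q e)"
proof (intro exI conjI ballI)
  define m where "m = Max S"
  have m: "m \<in> S" using assms unfolding m_def by (intro Max_in) auto
  have m_greater: "y < m" if "y \<in> S - {m}" for y
    using that assms(1) by (simp add: m_def le_neq_trans)
  let ?d = "\<lambda>y. delta y m"
  have step: "?d z < ?d y \<and> Q {?d y, ?d z}"
    if "y \<in> S - {m}" "z \<in> S - {m}" "y < z" for y z
    using assms(4)[of y z m] m m_greater[of z] delta_max[of y z m] that by auto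
  let ?K = "?d ` (S - {m})"
  have "inj_on ?d (S - {m})"
    using step by (metis (no_types, lifting) inj_onI less_irrefl linorder_neqE_nat)
  then show "card S = card ?K + 1"
    using m assms(1,2) by (simp add: card_image)
  show "?K \<subseteq> {..<n}"
    using assms(3) m by (auto intro!: delta_less)
  show "Q e" if "e \<in> [?K]\<^bsup>2\<^esup>" for e
  proof -
    obtain y z where "y \<in> S - {m}" "z \<in> S - {m}" "y < z" "e = {?d y, ?d z}"
      using \<open>e \<in> _\<close>
      by (elim nsets2_E) (auto, metis insert_commute linorder_neqE_nat)
    then show ?thesis using step by blast
  qed
qed

text \<open>Induction down the binary tree: digit \<open>n\<close> splits \<open>S\<close> into
  halves, and each genuine split adds \<open>n\<close> to the clique of the larger half. Requiring
  every member of \<open>K\<close> to be realised by a pair of \<open>S\<close> is what lets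
  \<open>n\<close> be joined to it.\<close>

lemma branch_delta_clique:
  assumes "finite S" "\<And>x. x \<in> S \<Longrightarrow> x div 2 ^ n = c"
    and "\<And>x y z. \<lbrakk>x \<in> S; y \<in> S; z \<in> S; x < y; y < z\<rbrakk> \<Longrightarrow> P {delta x y, delta y z}"
  shows "\<exists>K \<subseteq> {delta x y | x y. x \<in> S \<and> y \<in> S \<and> x < y}.
    (\<forall>e \<in> [K]\<^bsup>2\<^esup>. P e) \<and> card S \<le> 2 ^ card K"
  using assms
proof (induction n arbitrary: S c)
  case 0
  then have "S \<subseteq> {c}" by auto
  then have "card S \<le> 1" using card_mono[of "{c}" S] by simp
  then show ?case
    by (intro exI[of _ "{}"]) (auto simp: nsets_empty_iff)
next
  case (Suc n)
  define L where "L = {x \<in> S. x div 2 ^ n = 2 * c}"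
  define R where "R = {x \<in> S. x div 2 ^ n = 2 * c + 1}"
  have "x div 2 ^ n div 2 = c" if "x \<in> S" for x
    using Suc.prems(2)[OF that] by (simp only: power_Suc2 div_mult2_eq)
  then have "x div 2 ^ n = 2 * c \<or> x div 2 ^ n = 2 * c + 1" if "x \<in> S" for x
    using that by fastforce
  then have S: "S = L \<union> R" unfolding L_def R_def by blast
  have fin: "finite L" "finite R" using Suc.prems(1) S by auto
  have LR: "x < y \<and> delta x y = n" if "x \<in> L" "y \<in> R" for x y
  proof
    have "x div 2 ^ n < y div 2 ^ n" using that by (simp add: L_def R_def)
    then show "x < y" by (meson div_le_mono leD leI)
    show "delta x y = n"
      using that Suc.prems(2) by (intro delta_eqI) (auto simp: L_def R_def)
  qed
  have IH: "\<exists>K \<subseteq> {delta x y | x y. x \<in> T \<and> y \<in> T \<and> x < y}. (\<forall>e \<in> [K]\<^bsup>2\<^esup>. P e) \<and> card T \<le> 2 ^ card K"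
    if "T = L \<or> T = R" for T
  proof -
    have "\<exists>c. \<forall>x \<in> T. x div 2 ^ n = c" and T: "T \<subseteq> S" using that by (auto simp: L_def R_def)
    then obtain c' where c': "\<And>x. x \<in> T \<Longrightarrow> x div 2 ^ n = c'" by blast
    show ?thesis
    proof (rule Suc.IH[OF _ c'])
      show "finite T" using T Suc.prems(1) by (rule finite_subset)
      show "P {delta x y, delta y z}" if "x \<in> T" "y \<in> T" "z \<in> T" "x < y" "y < z" for x y z
        using that T by (intro Suc.prems(3)) auto
    qed
  qed
  show ?case
  proof (cases "L = {} \<or> R = {}")
    case True
    then have "S = L \<or> S = R" using S by auto
    then show ?thesis by (rule IH)
  next
    case False
    then obtain a b where ab: "a \<in> L" "b \<in> R" by auto
    obtain T where T: "T = L \<or> T = R" "card S \<le> 2 * card T"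
      using card_Un_le[of L R] S
      by (metis (no_types, lifting) add_le_cancel_left add_le_cancel_right le_trans mult_2 nle_le)
    obtain K where K: "K \<subseteq> {delta x y | x y. x \<in> T \<and> y \<in> T \<and> x < y}"
        "\<And>e. e \<in> [K]\<^bsup>2\<^esup> \<Longrightarrow> P e" "card T \<le> 2 ^ card K"
      using IH[OF T(1)] by blast
    have new: "d < n \<and> P {d, n}" if d: "d \<in> K" for d
    proof -
      obtain x y where xy: "x \<in> T" "y \<in> T" "x < y" "d = delta x y"
        using d K(1) by blast
      have "x div 2 ^ n = y div 2 ^ n" using xy T(1) by (auto simp: L_def R_def)
      then have "d < n" using xy delta_less_iff[of x y n] by simp
      \<comment> \<open>An element of the other half completes the pair behind \<open>d\<close> to a
        triple, \<open>x < y < b\<close> or \<open>a < x < y\<close>, whose second digit is the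
        crossing digit \<open>n\<close>.\<close>
      moreover have "P {d, n}"
      proof (cases "T = L")
        case True
        then show ?thesis using Suc.prems(3)[of x y b] xy ab LR[of y b] S by auto
      next
        case False
        then show ?thesis
          using Suc.prems(3)[of a x y] xy ab LR[of a x] S T(1) by (auto simp: insert_commute)
      qed
      ultimately show ?thesis by simp
    qed
    have "K \<subseteq> {..<n}" using new by auto
    then have "finite K" by (rule finite_subset) simp
    moreover have "n \<notin> K" using new by blast
    ultimately have "card S \<le> 2 ^ card (insert n K)"
      using T(2) K(3) by simp
    moreover have "P e" if "e \<in> [insert n K]\<^bsup>2\<^esup>" for e
      using \<open>e \<in> _\<close> new K(2) by (elim nsets2_E) (auto simp: insert_commute)
    moreover have "n \<in> {delta x y | x y. x \<in> S \<and> y \<in> S \<and> x < y}"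
      using LR[OF ab] ab S by blast
    moreover have "K \<subseteq> {delta x y | x y. x \<in> S \<and> y \<in> S \<and> x < y}"
      using K(1) T(1) S by blast
    ultimately show ?thesis by (intro exI[of _ "insert n K"]) auto
  qed
qed

text \<open>\<open>P\<close> holds of the blue pairs. For \<open>x < y < z\<close> the two digits
  are distinct by \<open>delta_neq\<close>, so colour 1 means a strict descent.\<close>

definition step_colour :: "(nat set \<Rightarrow> bool) \<Rightarrow> nat \<Rightarrow> nat \<Rightarrow> nat \<Rightarrow> nat" where
  "step_colour P x y z =
     (if P {delta x y, delta y z} then 2 else if delta x y < delta y z then 0 else 1)"

lemma step_colour_eq_iff:
  "step_colour P x y z = 0 \<longleftrightarrow> \<not> P {delta x y, delta y z} \<and> delta x y < delta y z"
  "step_colour P x y z = 1 \<longleftrightarrow> \<not> P {delta x y, delta y z} \<and> \<not> delta x y < delta y z"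
  "step_colour P x y z = 2 \<longleftrightarrow> P {delta x y, delta y z}"
  by (simp_all add: step_colour_def)

text \<open>The bounds on \<open>card K\<close> match the sizes returned by the clique lemmas:
  \<open>2 ^ card K\<close> for the third colour, \<open>card K + 1\<close> for the first
  two.\<close>

lemma stepping_up:
  assumes blue: "\<And>K. \<lbrakk>K \<subseteq> {..<n}; \<forall>e \<in> [K]\<^bsup>2\<^esup>. P e\<rbrakk> \<Longrightarrow> 2 ^ card K < l"
    and red: "\<And>K. \<lbrakk>K \<subseteq> {..<n}; \<forall>e \<in> [K]\<^bsup>2\<^esup>. \<not> P e\<rbrakk> \<Longrightarrow> card K + 1 < l"
  shows "\<not> partn_lst {..<(2::nat) ^ n} [l, l, l] 3"
proof
  assume part: "partn_lst {..<(2::nat) ^ n} [l, l, l] 3"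
  \<comment> \<open>Sorting recovers the order of a triple from the bare set; the default 0 only
    serves sets that are not triples.\<close>
  define f where "f T = (case sorted_list_of_set T of [x, y, z] \<Rightarrow> step_colour P x y z | _ \<Rightarrow> 0)"
    for T
  have f: "f {x, y, z} = step_colour P x y z" if "x < y" "y < z" for x y z
  proof -
    have "sorted_list_of_set {x, y, z} = [x, y, z]"
      using that sorted_list_of_set.idem_if_sorted_distinct[of "[x, y, z]"] by simp
    then show ?thesis by (simp add: f_def)
  qed
  have "f \<in> [{..<2 ^ n}]\<^bsup>3\<^esup> \<rightarrow> {..<3}"
    by (auto simp: f_def step_colour_def split: list.splits)
  then obtain i S where iS: "i < length [l, l, l]" "S \<in> [{..<2 ^ n}]\<^bsup>([l, l, l] ! i)\<^esup>"
      and mono: "f ` [S]\<^bsup>3\<^esup> \<subseteq> {i}"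
    by (rule partn_lstE[OF part]) simp_all
  have i: "i < 3" using iS(1) by simp
  then have "[l, l, l] ! i = l" by (auto simp: less_Suc_eq numeral_3_eq_3)
  then have S: "S \<in> [{..<2 ^ n}]\<^bsup>l\<^esup>" using iS(2) by simp
  have col: "step_colour P x y z = i" if "x \<in> S" "y \<in> S" "z \<in> S" "x < y" "y < z" for x y z
  proof -
    have "{x, y, z} \<in> [S]\<^bsup>3\<^esup>" using that by (auto simp: nsets_def)
    then have "f {x, y, z} \<in> {i}" using mono by (meson image_subset_iff)
    then show ?thesis using f[OF that(4,5)] by simp
  qed
  \<comment> \<open>The empty clique already forces \<open>1 < l\<close>, so \<open>S\<close> has a
    minimum and a maximum.\<close>
  have "l \<ge> 1" using red[of "{}"] by (simp add: nsets_empty_iff)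
  then have S': "finite S" "S \<subseteq> {..<2 ^ n}" "card S = l" "card S \<ge> 1"
    using S by (auto simp: nsets_def)
  consider "i = 0" | "i = 1" | "i = 2" using i by linarith
  then show False
  proof cases
    case 1
    have step: "delta x y < delta y z \<and> \<not> P {delta x y, delta y z}"
      if "x \<in> S" "y \<in> S" "z \<in> S" "x < y" "y < z" for x y z
      using col[OF that] 1 by (simp add: step_colour_eq_iff)
    obtain K where "K \<subseteq> {..<n}" "card S = card K + 1" "\<forall>e \<in> [K]\<^bsup>2\<^esup>. \<not> P e"
      using increasing_delta_clique[of S n "\<lambda>e. \<not> P e", OF S'(1) S'(4) S'(2) step] by blast
    then show False using red[of K] S' by simp
  next
    case 2
    have step: "delta y z < delta x y \<and> \<not> P {delta x y, delta y z}"
      if "x \<in> S" "y \<in> S" "z \<in> S" "x < y" "y < z" for x y z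
    proof -
      have "step_colour P x y z = 1" using col[OF that] 2 by (rule trans)
      then show ?thesis
        using delta_neq[OF that(4,5)] unfolding step_colour_eq_iff by linarith
    qed
    obtain K where "K \<subseteq> {..<n}" "card S = card K + 1" "\<forall>e \<in> [K]\<^bsup>2\<^esup>. \<not> P e"
      using decreasing_delta_clique[of S n "\<lambda>e. \<not> P e", OF S'(1) S'(4) S'(2) step] by blast
    then show False using red[of K] S' by simp
  next
    case 3
    have step: "P {delta x y, delta y z}"
      if "x \<in> S" "y \<in> S" "z \<in> S" "x < y" "y < z" for x y z
      using col[OF that] 3 by (simp add: step_colour_eq_iff)
    have root: "x div 2 ^ n = 0" if "x \<in> S" for x using that S'(2) by auto
    obtain K where K: "K \<subseteq> {delta x y | x y. x \<in> S \<and> y \<in> S \<and> x < y}"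
        "\<forall>e \<in> [K]\<^bsup>2\<^esup>. P e" "card S \<le> 2 ^ card K"
      using branch_delta_clique[of S n 0 P, OF S'(1) root step] by blast
    have "K \<subseteq> {..<n}"
      using K(1) S'(2) by (force intro!: delta_less)
    then show False using blue[of K] K S' by simp
  qed
qed

lemma r3_greater:
  assumes "\<not> partn_lst {..<N} [k, l, m] 3"
  shows "N < r3 k l m"
  using assms partn_lst_greater_resource r3_welldefined by (meson leI)

section \<open>Graphs without large cliques and independent sets\<close>

text \<open>Used to count the bad colourings, those confined to the colours \<open>A\<close> on the
  pairs \<open>D\<close> of one vertex set.\<close>

lemma card_PiE_restricted:
  assumes "finite E" "D \<subseteq> E"
  shows "card (PiE E (\<lambda>e. if e \<in> D then A else C)) = card A ^ card D * card C ^ (card E - card D)"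
proof -
  have "E \<inter> D = D" "E \<inter> - D = E - D" using assms(2) by auto
  moreover have "card (E - D) = card E - card D"
    using assms by (meson card_Diff_subset finite_subset)
  ultimately show ?thesis
    using assms(1) by (simp add: card_PiE if_distrib[of card] prod.If_cases)
qed

text \<open>The colour classes \<open>0\<close> and \<open>{1..<q}\<close> of a random \<open>q\<close>-colouring have density \<open>1 / q\<close> and
  \<open>1 - 1 / q\<close>.\<close>

lemma random_graph:
  fixes n s t q :: nat
  assumes "q \<ge> 1"
    and less: "(n choose s) / q ^ (s choose 2) + (n choose t) * (1 - 1 / q) ^ (t choose 2) < (1::real)"
  obtains P where "\<And>K. K \<in> [{..<n}]\<^bsup>s\<^esup> \<Longrightarrow> \<exists>e \<in> [K]\<^bsup>2\<^esup>. \<not> P e"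
    and "\<And>K. K \<in> [{..<n}]\<^bsup>t\<^esup> \<Longrightarrow> \<exists>e \<in> [K]\<^bsup>2\<^esup>. P e"
proof -
  define E where "E = [{..<n}]\<^bsup>2\<^esup>"
  define F where "F = (\<Pi>\<^sub>E e \<in> E. {..<q})"
  \<comment> \<open>\<open>B A K\<close> is the event that all pairs in \<open>K\<close> receive
    colours from \<open>A\<close>; its probability is \<open>card A / q\<close> to the number of
    pairs in \<open>K\<close>.\<close>
  define B where "B A K = (\<Pi>\<^sub>E e \<in> E. if e \<in> [K]\<^bsup>2\<^esup> then A else {..<q})" for A and K :: "nat set"
  have finE: "finite E" by (simp add: E_def finite_imp_finite_nsets)
  have cardF: "card F = q ^ card E" by (simp add: F_def card_PiE finE)
  have cardB: "real (card (B A K)) = card F * (card A / q) ^ (r choose 2)"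
    if "K \<in> [{..<n}]\<^bsup>r\<^esup>" for A K r
  proof -
    have sub: "[K]\<^bsup>2\<^esup> \<subseteq> E" and K: "card K = r"
      using that by (auto simp: E_def nsets_def)
    have "r choose 2 \<le> card E" using card_mono[OF finE sub] K by simp
    then have "q ^ card E = q ^ (r choose 2) * q ^ (card E - (r choose 2))"
      by (simp flip: power_add)
    then show ?thesis
      using assms(1) K card_PiE_restricted[OF finE sub, of A "{..<q}"]
      by (simp add: cardF B_def power_divide)
  qed
  have bound: "real (card (\<Union>K \<in> [{..<n}]\<^bsup>r\<^esup>. B A K))
      \<le> card F * ((n choose r) * (card A / q) ^ (r choose 2))"
    for A r
  proof -
    have "real (card (\<Union>K \<in> [{..<n}]\<^bsup>r\<^esup>. B A K)) \<le> (\<Sum>K \<in> [{..<n}]\<^bsup>r\<^esup>. real (card (B A K)))"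
      by (metis card_UN_le finite_imp_finite_nsets finite_lessThan of_nat_mono of_nat_sum)
    also have "\<dots> = (\<Sum>K \<in> [{..<n}]\<^bsup>r\<^esup>. card F * (card A / q) ^ (r choose 2))"
      by (intro sum.cong refl cardB)
    finally show ?thesis by (simp add: mult_ac)
  qed
  let ?U = "(\<Union>K \<in> [{..<n}]\<^bsup>s\<^esup>. B {0} K) \<union> (\<Union>K \<in> [{..<n}]\<^bsup>t\<^esup>. B {1..<q} K)"
  have "card F > 0" using assms(1) by (simp add: cardF)
  have "real (card {1..<q}) / q = 1 - 1 / q"
    using assms(1) by (simp add: diff_divide_distrib)
  then have "real (card (\<Union>K \<in> [{..<n}]\<^bsup>t\<^esup>. B {1..<q} K))
      \<le> card F * ((n choose t) * (1 - 1 / q) ^ (t choose 2))"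
    using bound[where r = t and A = "{1..<q}"] by simp
  moreover have "real (card (\<Union>K \<in> [{..<n}]\<^bsup>s\<^esup>. B {0} K)) \<le> card F * ((n choose s) / q ^ (s choose 2))"
    using bound[where r = s and A = "{0}"] by (simp add: power_one_over)
  moreover have "real (card ?U) \<le> real (card (\<Union>K \<in> [{..<n}]\<^bsup>s\<^esup>. B {0} K))
      + real (card (\<Union>K \<in> [{..<n}]\<^bsup>t\<^esup>. B {1..<q} K))"
    by (metis card_Un_le of_nat_add of_nat_mono)
  ultimately have "real (card ?U) \<le> card F * ((n choose s) / q ^ (s choose 2))
      + card F * ((n choose t) * (1 - 1 / q) ^ (t choose 2))"
    by linarith
  also have "\<dots> < card F"
    using mult_strict_left_mono[OF less, of "card F"] \<open>card F > 0\<close> by (simp add: distrib_left)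
  finally have "card ?U < card F" by simp
  moreover have "finite ?U"
    using finE by (auto simp: B_def finite_imp_finite_nsets intro!: finite_PiE)
  ultimately have "\<not> F \<subseteq> ?U" using card_mono[of ?U F] by linarith
  \<comment> \<open>By the union bound some colouring avoids all bad events; its class 0 serves as
    \<open>P\<close>.\<close>
  then obtain f where f: "f \<in> F" "f \<notin> ?U" by blast
  have out: "\<exists>e \<in> [K]\<^bsup>2\<^esup>. f e \<notin> A" if "f \<notin> B A K" for A K
    using that f(1) by (auto simp: B_def F_def PiE_iff split: if_splits)
  show ?thesis
  proof
    show "\<exists>e \<in> [K]\<^bsup>2\<^esup>. \<not> f e = 0" if "K \<in> [{..<n}]\<^bsup>s\<^esup>" for K
      using out[of "{0}" K] f(2) that by auto
    show "\<exists>e \<in> [K]\<^bsup>2\<^esup>. f e = 0" if K: "K \<in> [{..<n}]\<^bsup>t\<^esup>" for K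
    proof -
      obtain e where e: "e \<in> [K]\<^bsup>2\<^esup>" "f e \<notin> {1..<q}" using out[of "{1..<q}" K] f(2) K by auto
      then have "e \<in> E" using K by (auto simp: E_def nsets_def)
      then have "f e < q" using f(1) by (auto simp: F_def)
      then show ?thesis using e by force
    qed
  qed
qed

lemma clique_card_less:
  assumes "\<And>K. K \<in> [V]\<^bsup>r\<^esup> \<Longrightarrow> \<exists>e \<in> [K]\<^bsup>2\<^esup>. \<not> Q e" "K \<subseteq> V" "finite K" "\<forall>e \<in> [K]\<^bsup>2\<^esup>. Q e"
  shows "card K < r"
proof (rule ccontr)
  assume "\<not> card K < r"
  then obtain J where "J \<subseteq> K" "card J = r" "finite J"
    using obtain_subset_with_card_n[of r K] by auto
  then have "J \<in> [V]\<^bsup>r\<^esup>" "[J]\<^bsup>2\<^esup> \<subseteq> [K]\<^bsup>2\<^esup>"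
    using assms(2) by (auto simp: nsets_def)
  then show False using assms(1,4) by blast
qed

section \<open>The lower bound\<close>

text \<open>The parameters are chosen such that the two terms of the union bound are at most
  \<open>2 powr (- k^2)\<close> and, by the assumption \<open>large\<close>, \<open>exp (- t)\<close>.\<close>

lemma r3_lower:
  fixes k l :: nat
  assumes "k \<ge> 1" "4 ^ k \<le> l"
    and large: "real k * (real k - 1) * ln 2 - (2 ^ (2 * k - 1) - 1) / 2 ^ (k + 1) \<le> -1"
  shows "2 ^ 2 ^ (k * (k - 1)) < r3 l l l"
proof -
  \<comment> \<open>Here \<open>2 ^ s = 2 * t = 4 ^ k\<close>, the size available below
    \<open>l\<close>. For \<open>l\<close> near \<open>4 ^ k\<close>, the density
    \<open>1 / q\<close> is about \<open>1 / sqrt l\<close> and \<open>log 2 n\<close> is quadratic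
    in \<open>log 2 l\<close>.\<close>
  define n where "n = (2::nat) ^ (k * (k - 1))"
  define q where "q = (2::nat) ^ k"
  define s where "s = 2 * k"
  define t where "t = (2::nat) ^ (2 * k - 1)"
  have s_choose: "s choose 2 = k * (2 * k - 1)"
    by (simp add: s_def choose_two)
  have t1: "t \<ge> 1" by (simp add: t_def)
  have choose_le: "real (n choose r) \<le> real n ^ r" for r
    by (cases "r \<le> n") (simp_all add: binomial_le_pow binomial_eq_0 flip: of_nat_power)
  have "(n choose s) / q ^ (s choose 2) \<le> real n ^ s / q ^ (s choose 2)"
    using choose_le by (intro divide_right_mono) auto
  also have "\<dots> = 2 powr (real (k * (k - 1) * s) - real (k * (s choose 2)))"
    by (simp add: n_def q_def powr_diff powr_realpow del: of_nat_mult flip: power_mult)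
  \<comment> \<open>The cubic terms \<open>2 * k ^ 3\<close> cancel, leaving
    \<open>k ^ 2 - 2 * k ^ 2\<close>.\<close>
  also have "real (k * (k - 1) * s) - real (k * (s choose 2)) = - real (k ^ 2)"
    unfolding s_choose using assms(1) by (simp add: s_def algebra_simps power2_eq_square)
  also have "2 powr (- real (k ^ 2)) \<le> 2 powr (-1)"
    using assms(1) by (intro powr_mono) auto
  finally have blue: "(n choose s) / q ^ (s choose 2) \<le> (1/2 :: real)"
    by (simp add: powr_minus)
  have "(1 - 1 / q) ^ (t choose 2) \<le> exp (- (1 / q)) ^ (t choose 2)"
    using exp_ge_add_one_self[of "- (1 / real q)"] by (intro power_mono) (auto simp: q_def)
  also have "\<dots> = exp (- (real (t choose 2) / q))"
    by (simp flip: exp_of_nat_mult)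
  also have "real (t choose 2) = t * (real t - 1) / 2"
    using t1 by (simp add: choose_two real_of_nat_div of_nat_diff)
  finally have "(n choose t) * (1 - 1 / q) ^ (t choose 2)
      \<le> real n ^ t * exp (- (t * (real t - 1) / 2 / q))"
    using choose_le[of t] by (intro mult_mono) (auto simp: q_def)
  also have "real n = exp (k * (k - 1) * ln 2)"
    by (simp add: n_def exp_of_nat_mult del: of_nat_mult)
  also have "\<dots> ^ t = exp (t * (k * (k - 1) * ln 2))"
    by (rule exp_of_nat_mult[symmetric])
  also have "\<dots> * exp (- (t * (real t - 1) / 2 / q))
      = exp (t * (real k * (real k - 1) * ln 2 - (real t - 1) / (2 * q)))"
    using assms(1) by (simp add: of_nat_diff algebra_simps flip: exp_add)
  also have "\<dots> \<le> exp (real t * (-1))"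
  proof -
    have "real t = 2 ^ (2 * k - 1)" "real (2 * q) = 2 ^ (k + 1)"
      by (simp_all add: t_def q_def)
    then show ?thesis
      using large by (simp only: exp_le_cancel_iff) (intro mult_left_mono, simp_all)
  qed
  finally have "(n choose t) * (1 - 1 / q) ^ (t choose 2) \<le> exp (real t * (-1))" .
  moreover have "exp (real t * (-1)) \<le> exp (-1)" using t1 by simp
  \<comment> \<open>Strictness comes from this term, since the blue one is only bounded by
    1/2.\<close>
  moreover have "exp (-1) < exp (- ln (2::real))"
    using ln_2_less_1 by simp
  then have "exp (-1) < (1/2 :: real)"
    by (simp add: exp_minus)
  ultimately have red: "(n choose t) * (1 - 1 / q) ^ (t choose 2) < (1/2 :: real)"
    by linarith
  have "q \<ge> 1" by (simp add: q_def)
  moreover have "(n choose s) / q ^ (s choose 2) + (n choose t) * (1 - 1 / q) ^ (t choose 2) < (1::real)"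
    using blue red by linarith
  ultimately obtain P where P: "\<And>K. K \<in> [{..<n}]\<^bsup>s\<^esup> \<Longrightarrow> \<exists>e \<in> [K]\<^bsup>2\<^esup>. \<not> P e"
      "\<And>K. K \<in> [{..<n}]\<^bsup>t\<^esup> \<Longrightarrow> \<exists>e \<in> [K]\<^bsup>2\<^esup>. P e"
    by (rule random_graph) blast
  have "(2::nat) ^ s = 4 ^ k" by (simp add: s_def power_mult)
  moreover have "2 * t = 2 ^ s" using assms(1) by (simp add: s_def t_def power_eq_if)
  ultimately have pow: "2 ^ s \<le> l" "2 * t \<le> l" using assms(2) by simp_all
  have "\<not> partn_lst {..<(2::nat) ^ n} [l, l, l] 3"
  proof (rule stepping_up[of n P])
    fix K assume K: "K \<subseteq> {..<n}" "\<forall>e \<in> [K]\<^bsup>2\<^esup>. P e"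
    then have "card K < s"
      using P(1) clique_card_less finite_subset[OF K(1)] by blast
    then have "(2::nat) ^ card K < 2 ^ s" by simp
    then show "2 ^ card K < l" using pow by linarith
  next
    fix K assume K: "K \<subseteq> {..<n}" "\<forall>e \<in> [K]\<^bsup>2\<^esup>. \<not> P e"
    then have "card K < t"
      using P(2) clique_card_less[of "{..<n}" t "\<lambda>e. \<not> P e" K] finite_subset[OF K(1)] by blast
    then show "card K + 1 < l" using pow t1 by linarith
  qed
  then show ?thesis using r3_greater by (simp add: n_def)
qed

theorem theorem1:
  shows "\<exists>c::real. c > 0 \<and>
    (\<forall>\<^sub>F l::nat in sequentially.
       real (r3 l l l) \<ge> 2 powr (real l powr (c * log 2 (log 2 (real l)))))"
proof (intro exI[of _ 1] conjI)
  \<comment> \<open>The largest \<open>k\<close> with \<open>4 ^ k \<le> l\<close>. Then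
    \<open>k * (k - 1)\<close> is of order \<open>(log l)^2\<close>, which outgrows
    \<open>log l * log (log l)\<close>, so the constant 1 suffices.\<close>
  define k where "k l = nat \<lfloor>log 4 (real l)\<rfloor>" for l
  have "filterlim k sequentially sequentially"
    unfolding k_def by real_asymp
  \<comment> \<open>The fraction grows like \<open>2 ^ (k - 2)\<close> and beats the quadratic
    term.\<close>
  moreover have "\<forall>\<^sub>F k in sequentially.
      real k * (real k - 1) * ln 2 - (2 ^ (2 * k - 1) - 1) / 2 ^ (k + 1) \<le> -1"
    by real_asymp
  moreover have "\<forall>\<^sub>F k in sequentially.
      (2 * real k + 2) * log 2 (2 * real k + 2) \<le> real k * (real k - 1)"
    by real_asymp
  ultimately have ev: "\<forall>\<^sub>F l in sequentially.
      real (k l) * (real (k l) - 1) * ln 2 - (2 ^ (2 * k l - 1) - 1) / 2 ^ (k l + 1) \<le> -1"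
      "\<forall>\<^sub>F l in sequentially.
        (2 * real (k l) + 2) * log 2 (2 * real (k l) + 2) \<le> real (k l) * (real (k l) - 1)"
      "\<forall>\<^sub>F l in sequentially. k l \<ge> 1"
    by (auto simp: filterlim_iff)
  show "\<forall>\<^sub>F l::nat in sequentially.
       real (r3 l l l) \<ge> 2 powr (real l powr (1 * log 2 (log 2 (real l))))"
    using ev eventually_ge_at_top[of 4]
  proof eventually_elim
    case (elim l)
    have log4: "log 4 (real l) = log 2 (real l) / 2"
      using elim(4) log_base_pow[of 2 2 "real l"] by simp
    have fl: "real (k l) \<le> log 4 l" "log 4 l < real (k l) + 1"
      using elim(4) by (auto simp: k_def le_floor_iff)
    have "4 powr real (k l) \<le> real l"
      using fl(1) elim(4) by (simp add: le_log_iff)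
    then have "4 ^ k l \<le> l" by (simp add: powr_realpow flip: of_nat_le_iff)
    then have r3: "2 ^ 2 ^ (k l * (k l - 1)) < r3 l l l"
      using elim by (intro r3_lower)
    have "real l powr log 2 (log 2 l) = 2 powr (log 2 l * log 2 (log 2 l))"
      using elim(4) by (simp flip: powr_powr)
    \<comment> \<open>The choice of \<open>k\<close> gives \<open>log 2 l < 2 * k + 2\<close>, and
      \<open>k \<ge> 1\<close> gives \<open>log 2 l \<ge> 2\<close>, so the iterated logarithm is
      nonnegative.\<close>
    moreover have "log 2 l * log 2 (log 2 l) \<le> (2 * real (k l) + 2) * log 2 (2 * real (k l) + 2)"
      using fl log4 elim(3) by (intro mult_mono) (auto intro!: log_mono)
    moreover have "2 powr (real (k l) * (real (k l) - 1)) = 2 ^ (k l * (k l - 1))"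
      using elim(3) powr_realpow[of 2 "k l * (k l - 1)"] by simp
    ultimately have "2 powr (real l powr log 2 (log 2 l)) \<le> 2 powr (2 ^ (k l * (k l - 1)))"
      using elim(2) by (smt (verit) powr_mono)
    also have "\<dots> = real (2 ^ 2 ^ (k l * (k l - 1)))"
      using powr_realpow[of 2 "2 ^ (k l * (k l - 1))"] by simp
    also have "\<dots> \<le> real (r3 l l l)"
      using r3 by (simp only: of_nat_le_iff)
    finally show ?case by simp
  qed
qed simp

end
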